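(* Let $Q$ be a query (a finite set of terms) and let $C_i$ be a non-empty cluster of documents, partitioned into $n\ge 1$ segments $S_{i,1},\dots,S_{i,n}$. Then $$BoundSum(C_i)\;\ge\; MaxSBound(C_i)\;\ge\; \max_{d\in C_i} RankScore(d).$$
   Context: A finite document collection is given. For every document $d$ and every term $t$ there is a weight $w_{t,d}\ge 0$ (zero if $t$ does not occur in $d$). A query is a finite set $Q$ of terms. The rank score of a document $d$ is $RankScore(d)=\sum_{t\in Q} w_{t,d}$. A cluster $C_i$ is a finite set of documents; it is subdivided into $n$ pairwise disjoint segments $S_{i,1},\dots,S_{i,n}$ whose union is $C_i$. A maximum of weights over an empty segment is taken to be $0$. The cluster bound is $BoundSum(C_i)=\sum_{t\in Q}\max_{d\in C_i} w_{t,d}$. The segment bounds are $B_{i,j}=\sum_{t\in Q}\max_{d\in S_{i,j}} w_{t,d}$ for $1\le j\le n$, and $MaxSBound(C_i)=\max_{1\le j\le n} B_{i,j}$. *)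

theory Defs
  imports Complex_Main "HOL-Library.Disjoint_Sets"
begin

definition rank_score :: "('t \<Rightarrow> 'd \<Rightarrow> real) \<Rightarrow> 't set \<Rightarrow> 'd \<Rightarrow> real" where
  "rank_score w Q d = (\<Sum>t\<in>Q. w t d)"

(* The maximum of no weights is 0 by convention; Max {} would be unspecified. *)
definition max_weight :: "('t \<Rightarrow> 'd \<Rightarrow> real) \<Rightarrow> 't \<Rightarrow> 'd set \<Rightarrow> real" where
  "max_weight w t S = (if S = {} then 0 else Max ((\<lambda>d. w t d) ` S))"

definition bound_sum :: "('t \<Rightarrow> 'd \<Rightarrow> real) \<Rightarrow> 't set \<Rightarrow> 'd set \<Rightarrow> real" where
  "bound_sum w Q C = (\<Sum>t\<in>Q. max_weight w t C)"

definition segment_bound ::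
  "('t \<Rightarrow> 'd \<Rightarrow> real) \<Rightarrow> 't set \<Rightarrow> (nat \<Rightarrow> 'd set) \<Rightarrow> nat \<Rightarrow> real" where
  "segment_bound w Q S j = (\<Sum>t\<in>Q. max_weight w t (S j))"

(* The subdivision S 1, ..., S n of the cluster is an explicit argument; it determines
   the cluster as its union. Meaningful for n >= 1 only. *)
definition max_segment_bound ::
  "('t \<Rightarrow> 'd \<Rightarrow> real) \<Rightarrow> 't set \<Rightarrow> nat \<Rightarrow> (nat \<Rightarrow> 'd set) \<Rightarrow> real" where
  "max_segment_bound w Q n S = Max ((\<lambda>j. segment_bound w Q S j) ` {1..n})"

(* Segments are pairwise disjoint as an indexed family and may be empty, so
   partition_on (which excludes empty blocks) is not applicable. *)
definition segmentation :: "nat \<Rightarrow> (nat \<Rightarrow> 'd set) \<Rightarrow> 'd set \<Rightarrow> bool" where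
  "segmentation n S C \<longleftrightarrow> disjoint_family_on S {1..n} \<and> (\<Union>j\<in>{1..n}. S j) = C"

end

theory Submission
  imports Defs
begin

text \<open>Both inequalities are checked term by term and then summed over \<open>Q\<close>. A
  maximum over a segment cannot exceed the maximum over the whole cluster
  (\<open>max_weight_mono\<close>), so every segment bound, and hence the largest, is at most the
  cluster bound. Conversely, each document lies in some segment, whose termwise maxima dominate its
  weights (\<open>max_weight_upper\<close>), so its score is at most the bound of that
  segment.\<close>

lemma max_weight_upper:
  assumes "finite A" "d \<in> A"
  shows "w t d \<le> max_weight w t A"
  using assms by (auto simp: max_weight_def)

text \<open>Segments may be empty, and then the maximum is 0 by convention; nonnegative weights keep
  this value below the maximum over \<open>B\<close>. For nonempty \<open>A\<close> this is ordinary
  monotonicity of \<open>Max\<close>.\<close>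

lemma max_weight_mono:
  assumes "finite B" "A \<subseteq> B" "\<And>d. d \<in> B \<Longrightarrow> w t d \<ge> 0"
  shows "max_weight w t A \<le> max_weight w t B"
proof (cases "A = {}")
  case True
  have "0 \<le> max_weight w t B"
  proof (cases "B = {}")
    case False
    then obtain d where "d \<in> B" by blast
    then show ?thesis
      using assms(3)[of d] max_weight_upper[OF assms(1), of d w t] by simp
  qed (simp add: max_weight_def)
  with True show ?thesis by (simp add: max_weight_def)
next
  case False
  with assms show ?thesis
    by (auto simp: max_weight_def intro!: Max_mono)
qed

theorem proposition1:
  fixes D C :: "'d set"
    and Q :: "'t set"
    and occurs :: "'t \<Rightarrow> 'd \<Rightarrow> bool"
    and w :: "'t \<Rightarrow> 'd \<Rightarrow> real"
    and n :: nat
    and S :: "nat \<Rightarrow> 'd set"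
  assumes "finite D"
    and "\<And>t d. d \<in> D \<Longrightarrow> w t d \<ge> 0"
    and "\<And>t d. d \<in> D \<Longrightarrow> \<not> occurs t d \<Longrightarrow> w t d = 0"
    and "finite Q"
    and "C \<subseteq> D" and "C \<noteq> {}"
    and "n \<ge> 1" and "segmentation n S C"
  shows "bound_sum w Q C \<ge> max_segment_bound w Q n S
       \<and> max_segment_bound w Q n S \<ge> Max ((\<lambda>d. rank_score w Q d) ` C)"
proof
  have finC: "finite C"
    using assms(5,1) by (rule finite_subset)
  have nonneg: "w t d \<ge> 0" if "d \<in> C" for t d
    using assms(2)[of d] assms(5) that by blast
  have cover: "(\<Union>j\<in>{1..n}. S j) = C"
    using assms(8) by (simp add: segmentation_def)
  have "segment_bound w Q S j \<le> bound_sum w Q C" if "j \<in> {1..n}" for j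
  proof -
    have "S j \<subseteq> C" using cover that by blast
    then show ?thesis
      unfolding segment_bound_def bound_sum_def
      using finC nonneg by (intro sum_mono max_weight_mono)
  qed
  \<comment> \<open>Since \<open>n \<ge> 1\<close>, the maximum is over a nonempty index set, so
    bounding each segment suffices.\<close>
  then show "max_segment_bound w Q n S \<le> bound_sum w Q C"
    using assms(7) by (simp add: max_segment_bound_def)
  have "rank_score w Q d \<le> max_segment_bound w Q n S" if "d \<in> C" for d
  proof -
    \<comment> \<open>The segment containing \<open>d\<close> is the intermediate term: its bound
      lies between the score of \<open>d\<close> and the largest segment bound.\<close>
    obtain j where j: "j \<in> {1..n}" "d \<in> S j"
      using cover \<open>d \<in> C\<close> by blast
    have "S j \<subseteq> C" using cover j(1) by blast
    then have "finite (S j)" using finC by (rule finite_subset)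
    then have "rank_score w Q d \<le> segment_bound w Q S j"
      unfolding rank_score_def segment_bound_def
      using j(2) by (intro sum_mono max_weight_upper)
    also have "\<dots> \<le> max_segment_bound w Q n S"
      unfolding max_segment_bound_def using j(1) by (intro Max_ge) auto
    finally show ?thesis .
  qed
  then show "Max ((\<lambda>d. rank_score w Q d) ` C) \<le> max_segment_bound w Q n S"
    using finC assms(6) by simp
qed

end
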